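(* Let $q$ be a prime power, let $n\ge 1$ and $d\ge 0$ be integers, and let $Y$ be a subset of $\mathbb{F}_q^n$. Then $$ {}^a\mathrm{HF}(\mathbb{F}_q^n,d)\,|\mathrm{cl}_d(Y)| \leq q^n\, |Y|. $$
   Context: $\mathbb{F}_q$ is the finite field with $q$ elements. For a field $k$, let $A=k[x_1,\dots,x_n]$, and for a set $J\subset A$ let $J_{\le d}$ be the set of polynomials in $J$ of (total) degree at most $d$. For a subset $X\subset k^n$, $I(X)\subset A$ is the ideal of polynomials vanishing at every point of $X$. The affine Hilbert function of $X$ is ${}^a\mathrm{HF}(X,d)=\dim_k A_{\le d}/I(X)_{\le d}=\dim_k A_{\le d}-\dim_k I(X)_{\le d}$. The degree $d$ closure of $Y\subset k^n$ is $\mathrm{cl}_d(Y)=\{x\in k^n : \text{every polynomial in } A \text{ of degree at most } d \text{ vanishing on } Y \text{ vanishes at } x\}$. Here $k=\mathbb{F}_q$. *)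

theory Defs
  imports "HOL-Analysis.Finite_Cartesian_Product" "HOL-Library.Poly_Mapping"
begin

text \<open>
  The polynomial ring \<open>A = k[x\<^sub>1,\<dots>,x\<^sub>n]\<close> is modelled by finitely supported maps from exponent vectors
  to coefficients; the variables are indexed by a finite type \<open>'n\<close>, so \<open>n = CARD('n)\<close> is at least 1.
\<close>

type_synonym ('n, 'k) mpolynomial = "('n \<Rightarrow>\<^sub>0 nat) \<Rightarrow>\<^sub>0 'k"

definition mp_eval :: "('n::finite, 'k::field) mpolynomial \<Rightarrow> 'k ^ 'n \<Rightarrow> 'k" where
  "mp_eval p x =
    (\<Sum>m\<in>Poly_Mapping.keys p. Poly_Mapping.lookup p m * (\<Prod>i\<in>UNIV. (x $ i) ^ Poly_Mapping.lookup m i))"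

definition mon_degree :: "('n::finite \<Rightarrow>\<^sub>0 nat) \<Rightarrow> nat" where
  "mon_degree m = (\<Sum>i\<in>UNIV. Poly_Mapping.lookup m i)"

text \<open>
  The zero polynomial gets degree 0; since only conditions of the form \<open>degree \<le> d\<close> with
  \<open>d \<ge> 0\<close> occur, this agrees with the convention that its degree is negative or \<open>-\<infinity>\<close>.
\<close>

definition total_degree :: "('n::finite, 'k::zero) mpolynomial \<Rightarrow> nat" where
  "total_degree p = Max (insert 0 (mon_degree ` Poly_Mapping.keys p))"

definition deg_le :: "('n::finite, 'k::zero) mpolynomial set \<Rightarrow> nat \<Rightarrow> ('n, 'k) mpolynomial set" where
  "deg_le J d = {p \<in> J. total_degree p \<le> d}"

definition vanishing_ideal :: "('k::field ^ 'n::finite) set \<Rightarrow> ('n, 'k) mpolynomial set" where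
  "vanishing_ideal X = {p. \<forall>x\<in>X. mp_eval p x = 0}"

definition mp_scale :: "'k::field \<Rightarrow> ('n, 'k) mpolynomial \<Rightarrow> ('n, 'k) mpolynomial" where
  "mp_scale c p = Poly_Mapping.map ((*) c) p"

lemma lookup_mp_scale: "Poly_Mapping.lookup (mp_scale c p) m = c * Poly_Mapping.lookup p m"
  by (simp add: mp_scale_def Poly_Mapping.map.rep_eq when_def)

global_interpretation mp: vector_space mp_scale
  by unfold_locales
    (auto intro!: poly_mapping_eqI simp: lookup_mp_scale lookup_add algebra_simps)

text \<open>
  Truncated subtraction is harmless: \<open>I(X)\<^bsub>\<le>d\<^esub>\<close> is a subspace of \<open>A\<^bsub>\<le>d\<^esub>\<close>, which is finite-dimensional
  (spanned by the finitely many monomials of degree at most \<open>d\<close>), so the difference is the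
  dimension of the quotient.
\<close>

definition affine_HF :: "('k::field ^ 'n::finite) set \<Rightarrow> nat \<Rightarrow> nat" where
  "affine_HF X d =
    mp.dim (deg_le (UNIV :: ('n, 'k) mpolynomial set) d) - mp.dim (deg_le (vanishing_ideal X) d)"

definition degree_closure :: "nat \<Rightarrow> ('k::field ^ 'n::finite) set \<Rightarrow> ('k ^ 'n) set" where
  "degree_closure d Y = {x. \<forall>p\<in>deg_le (vanishing_ideal Y) d. mp_eval p x = 0}"

end

theory Submission
  imports Defs
begin

text \<open>
  Call \<open>B\<close> separated if polynomials of degree at most \<open>d\<close> can distinguish each of its points from the
  others. Separated sets are the independent sets of the matroid of evaluations at points, and the
  rank of \<open>X\<close> in it is the affine Hilbert function of \<open>X\<close>. Let \<open>B\<close> be a maximal separated subset of the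
  whole space. Translations preserve the degree, so every translate of \<open>B\<close> is separated, and its part
  inside \<open>C = cl\<^sub>d(Y)\<close> has at most \<open>rank C = rank Y \<le> |Y|\<close> points. Summing over the \<open>q\<^sup>n\<close> translates
  counts every pair in \<open>B \<times> C\<close> exactly once.
\<close>

text \<open>The kernel of a nonzero functional is a hyperplane: adding \<open>v\<close> to a basis
  of the kernel gives a basis of \<open>V\<close>. The finite spanning set matters because
  \<open>dim\<close> is a cardinality, and an infinite basis would have cardinality 0.\<close>

lemma (in vector_space) dim_kernel_functional:
  assumes V: "subspace V" and E: "V \<subseteq> span E" "finite E"
    and add: "\<And>x y. f (x + y) = f x + f y"
    and scale: "\<And>c x. f (scale c x) = c * f x"
    and v: "v \<in> V" "f v \<noteq> 0"
  shows "dim V = Suc (dim {w \<in> V. f w = 0})"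
proof -
  let ?W = "{w \<in> V. f w = 0}"
  have f0: "f 0 = 0" using scale[of 0 0] by simp
  have W: "subspace ?W"
    using V by (auto simp: subspace_def add scale f0)
  obtain B where B: "B \<subseteq> ?W" "independent B" "?W \<subseteq> span B" "card B = dim ?W"
    using basis_exists by blast
  have "B \<subseteq> span E" using B(1) E(1) by auto
  then have fin: "finite B" using independent_span_bound[OF E(2) B(2)] by simp
  have "span B \<subseteq> ?W" using B(1) W by (rule span_minimal)
  then have nv: "v \<notin> span B" using v by auto
  have ind: "independent (insert v B)"
    using nv B(2) by (simp add: independent_insert span_base)
  have "x \<in> span (insert v B)" if x: "x \<in> V" for x
  proof -
    \<comment> \<open>The coefficient is chosen so that \<open>f w = 0\<close>.\<close>
    define w where "w = x + scale (- (f x / f v)) v"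
    have "w \<in> V" unfolding w_def using V x v by (intro subspace_add subspace_scale)
    moreover have "f w = 0" using v by (simp add: w_def add scale del: scale_minus_left)
    ultimately have "w \<in> span (insert v B)" using B(3) span_mono[of B "insert v B"] by blast
    then have "w + scale (f x / f v) v \<in> span (insert v B)"
      by (rule span_add[OF _ span_scale[OF span_base]]) simp
    then show ?thesis by (simp add: w_def)
  qed
  then have "dim V = card (insert v B)"
    using B(1) v ind by (intro dim_unique) auto
  moreover have "v \<notin> B" using nv span_base by blast
  ultimately show ?thesis using fin B(4) by simp
qed

section \<open>Polynomials of bounded degree\<close>

definition mon_eval :: "('n::finite \<Rightarrow>\<^sub>0 nat) \<Rightarrow> 'k::field ^ 'n \<Rightarrow> 'k" where
  "mon_eval m x = (\<Prod>i\<in>UNIV. (x $ i) ^ Poly_Mapping.lookup m i)"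

lemma mp_eval_superset:
  assumes "finite K" "Poly_Mapping.keys p \<subseteq> K"
  shows "mp_eval p x = (\<Sum>m\<in>K. Poly_Mapping.lookup p m * mon_eval m x)"
  unfolding mp_eval_def mon_eval_def
  using assms by (intro sum.mono_neutral_left) (auto simp: in_keys_iff)

lemma mp_eval_add: "mp_eval (p + q) x = mp_eval p x + mp_eval q x"
proof -
  let ?K = "Poly_Mapping.keys p \<union> Poly_Mapping.keys q"
  have "Poly_Mapping.keys (p + q) \<subseteq> ?K" by (rule Poly_Mapping.keys_add)
  then show ?thesis
    by (simp add: mp_eval_superset[of ?K] lookup_add algebra_simps sum.distrib)
qed

lemma keys_mp_scale: "Poly_Mapping.keys (mp_scale c p) \<subseteq> Poly_Mapping.keys p"
  by (auto simp: in_keys_iff lookup_mp_scale)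

lemma mp_eval_scale: "mp_eval (mp_scale c p) x = c * mp_eval p x"
  using keys_mp_scale[of c p]
  by (simp add: mp_eval_superset[of "Poly_Mapping.keys p"] lookup_mp_scale sum_distrib_left
      mult.assoc)

lemma mp_eval_0: "mp_eval 0 x = 0"
  by (simp add: mp_eval_def)

lemma mp_eval_single: "mp_eval (Poly_Mapping.single m c) x = c * mon_eval m x"
  by (subst mp_eval_superset[of "{m}"]) auto

lemma total_degree_le_iff:
  "total_degree p \<le> d \<longleftrightarrow> (\<forall>m\<in>Poly_Mapping.keys p. mon_degree m \<le> d)"
  by (auto simp: total_degree_def)

lemma subspace_deg_le_vanishing_ideal: "mp.subspace (deg_le (vanishing_ideal X) d)"
  unfolding mp.subspace_def
  by (auto simp: deg_le_def vanishing_ideal_def total_degree_le_iff mp_eval_0 mp_eval_add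
      mp_eval_scale dest: subsetD[OF keys_mp_scale] subsetD[OF Poly_Mapping.keys_add])

lemma vanishing_ideal_empty: "vanishing_ideal {} = UNIV"
  by (simp add: vanishing_ideal_def)

lemma subspace_deg_le: "mp.subspace (deg_le UNIV d)"
  using subspace_deg_le_vanishing_ideal[of "{}" d] by (simp add: vanishing_ideal_empty)

text \<open>Each exponent is at most the degree, so the exponent vectors lie in a finite
  box.\<close>

lemma finite_mon_degree_le: "finite {m :: 'n::finite \<Rightarrow>\<^sub>0 nat. mon_degree m \<le> d}"
proof -
  have "Poly_Mapping.lookup m i \<le> mon_degree m" for m :: "'n \<Rightarrow>\<^sub>0 nat" and i
    unfolding mon_degree_def by (rule member_le_sum) auto
  then have "Poly_Mapping.lookup ` {m :: 'n \<Rightarrow>\<^sub>0 nat. mon_degree m \<le> d} \<subseteq> PiE UNIV (\<lambda>_. {..d})"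
    by (fastforce intro: order_trans)
  then have "finite (Poly_Mapping.lookup ` {m :: 'n \<Rightarrow>\<^sub>0 nat. mon_degree m \<le> d})"
    by (rule finite_subset) (auto intro: finite_PiE)
  then show ?thesis
    by (rule finite_imageD) (auto simp: inj_on_def lookup_inject)
qed

lemma mp_monomial_expansion:
  "p = (\<Sum>m\<in>Poly_Mapping.keys p. mp_scale (Poly_Mapping.lookup p m) (Poly_Mapping.single m 1))"
  by (rule poly_mapping_eqI)
    (simp add: lookup_sum lookup_mp_scale lookup_single when_def in_keys_iff if_distrib
      sum.delta cong: if_cong)

lemma deg_le_subset_span_monomials:
  "deg_le UNIV d \<subseteq> mp.span ((\<lambda>m. Poly_Mapping.single m 1) ` {m. mon_degree m \<le> d})"
proof
  fix p :: "('a, 'b) mpolynomial"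
  assume "p \<in> deg_le UNIV d"
  then have "\<forall>m\<in>Poly_Mapping.keys p. mon_degree m \<le> d"
    by (simp add: deg_le_def total_degree_le_iff)
  then have "(\<Sum>m\<in>Poly_Mapping.keys p. mp_scale (Poly_Mapping.lookup p m) (Poly_Mapping.single m 1))
    \<in> mp.span ((\<lambda>m. Poly_Mapping.single m 1) ` {m. mon_degree m \<le> d})"
    by (intro mp.span_sum mp.span_scale mp.span_base) auto
  then show "p \<in> mp.span ((\<lambda>m. Poly_Mapping.single m 1) ` {m. mon_degree m \<le> d})"
    by (simp flip: mp_monomial_expansion)
qed

section \<open>Translation\<close>

text \<open>Working with functions instead of polynomials lets translates be treated without
  multiplying or substituting in the polynomial ring; the degree bound only asks for some
  representing polynomial.\<close>

definition polyfun :: "nat \<Rightarrow> ('k::field ^ 'n::finite \<Rightarrow> 'k) set" where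
  "polyfun d = mp_eval ` deg_le UNIV d"

lemma polyfun_add:
  assumes "f \<in> polyfun d" "g \<in> polyfun d"
  shows "(\<lambda>x. f x + g x) \<in> polyfun d"
proof -
  obtain p q where "p \<in> deg_le UNIV d" "q \<in> deg_le UNIV d" "f = mp_eval p" "g = mp_eval q"
    using assms by (auto simp: polyfun_def)
  then show ?thesis
    unfolding polyfun_def
    by (intro image_eqI[of _ _ "p + q"]) (auto simp: mp_eval_add mp.subspace_add[OF subspace_deg_le])
qed

lemma polyfun_scale:
  assumes "f \<in> polyfun d"
  shows "(\<lambda>x. c * f x) \<in> polyfun d"
proof -
  obtain p where "p \<in> deg_le UNIV d" "f = mp_eval p"
    using assms by (auto simp: polyfun_def)
  then show ?thesis
    unfolding polyfun_def
    by (intro image_eqI[of _ _ "mp_scale c p"])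
      (auto simp: mp_eval_scale mp.subspace_scale[OF subspace_deg_le])
qed

lemma polyfun_sum:
  assumes "\<And>i. i \<in> I \<Longrightarrow> f i \<in> polyfun d"
  shows "(\<lambda>x. \<Sum>i\<in>I. f i x) \<in> polyfun d"
proof -
  have "(\<lambda>x. 0) \<in> polyfun d"
    unfolding polyfun_def
    by (intro image_eqI[of _ _ 0]) (auto simp: mp_eval_0 mp.subspace_0[OF subspace_deg_le])
  then show ?thesis
    using assms by (induction I rule: infinite_finite_induct) (auto intro: polyfun_add)
qed

lemma polyfun_mon_eval: "mon_degree m \<le> d \<Longrightarrow> mon_eval m \<in> polyfun d"
  unfolding polyfun_def
  by (intro image_eqI[of _ _ "Poly_Mapping.single m 1"])
    (auto simp: mp_eval_single deg_le_def total_degree_le_iff)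

lemma polyfun_mono: "f \<in> polyfun d \<Longrightarrow> d \<le> e \<Longrightarrow> f \<in> polyfun e"
  by (auto simp: polyfun_def deg_le_def)

lemma mon_eval_add_single:
  "mon_eval (m + Poly_Mapping.single i 1) x = mon_eval m x * x $ i"
proof -
  have "(\<Prod>j\<in>UNIV. x $ j ^ Poly_Mapping.lookup (Poly_Mapping.single i 1) j) =
      (\<Prod>j\<in>UNIV. if j = i then x $ j else 1)"
    by (rule prod.cong) (auto simp: lookup_single when_def)
  then show ?thesis
    by (simp add: mon_eval_def lookup_add power_add prod.distrib)
qed

lemma mon_degree_add_single: "mon_degree (m + Poly_Mapping.single i 1) = Suc (mon_degree m)"
  by (simp add: mon_degree_def lookup_add sum.distrib lookup_single when_def)

lemma polyfun_times_var:
  assumes "f \<in> polyfun d"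
  shows "(\<lambda>x. f x * x $ i) \<in> polyfun (Suc d)"
proof -
  obtain p where p: "p \<in> deg_le UNIV d" and f: "f = mp_eval p"
    using assms by (auto simp: polyfun_def)
  have eq: "(\<lambda>x. f x * x $ i) = (\<lambda>x. \<Sum>m\<in>Poly_Mapping.keys p.
      Poly_Mapping.lookup p m * mon_eval (m + Poly_Mapping.single i 1) x)"
    by (simp only: f mp_eval_superset[OF finite_keys order_refl] mon_eval_add_single
        sum_distrib_right mult.assoc)
  have "mon_degree m \<le> d" if "m \<in> Poly_Mapping.keys p" for m
    using p that by (simp add: deg_le_def total_degree_le_iff)
  then show ?thesis
    unfolding eq
    by (intro polyfun_sum polyfun_scale polyfun_mon_eval) (simp only: mon_degree_add_single Suc_le_mono)
qed

text \<open>Induction on the degree: split off one variable and expand its translated factor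
  \<open>x $ i + g $ i\<close>. The first term raises the degree by one, the second keeps
  it.\<close>

lemma polyfun_mon_eval_translate:
  fixes g :: "'k::field ^ 'n::finite"
  shows "(\<lambda>x. mon_eval m (x + g)) \<in> polyfun (mon_degree m)"
proof (induction "mon_degree m" arbitrary: m)
  case 0
  then have "mon_eval m = (\<lambda>_ :: 'k ^ 'n. 1)"
    by (simp add: fun_eq_iff mon_eval_def mon_degree_def)
  then show ?case
    using polyfun_mon_eval[OF order_refl, of m, where 'b = 'k] by simp
next
  case (Suc d)
  have "\<exists>i. Poly_Mapping.lookup m i \<noteq> 0"
    using Suc.hyps(2) by (auto simp: mon_degree_def intro: ccontr)
  then obtain i where i: "Poly_Mapping.lookup m i \<noteq> 0" by blast
  define m' where "m' = m - Poly_Mapping.single i 1"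
  have m: "m = m' + Poly_Mapping.single i 1"
    \<comment> \<open>Truncated subtraction is exact here because the exponent of \<open>i\<close>
      in \<open>m\<close> is positive.\<close>
    using i by (intro poly_mapping_eqI) (auto simp: m'_def lookup_add lookup_minus lookup_single when_def)
  have deg: "mon_degree m = Suc (mon_degree m')"
    unfolding m by (rule mon_degree_add_single)
  have IH: "(\<lambda>x. mon_eval m' (x + g)) \<in> polyfun (mon_degree m')"
    using Suc.hyps deg by simp
  then have "(\<lambda>x. mon_eval m' (x + g) * x $ i + g $ i * mon_eval m' (x + g)) \<in> polyfun (mon_degree m)"
    unfolding deg
    by (intro polyfun_add polyfun_times_var polyfun_scale polyfun_mono[OF IH]) simp_all
  also have "(\<lambda>x. mon_eval m' (x + g) * x $ i + g $ i * mon_eval m' (x + g)) =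
      (\<lambda>x. mon_eval m (x + g))"
    unfolding m by (simp only: mon_eval_add_single vector_add_component) (simp add: algebra_simps)
  finally show ?case .
qed

lemma deg_le_translate:
  assumes "p \<in> deg_le UNIV d"
  obtains p' where "p' \<in> deg_le UNIV d" "\<And>x. mp_eval p' x = mp_eval p (x + g)"
proof -
  have "mon_degree m \<le> d" if "m \<in> Poly_Mapping.keys p" for m
    using assms that by (simp add: deg_le_def total_degree_le_iff)
  then have "(\<lambda>x. \<Sum>m\<in>Poly_Mapping.keys p. Poly_Mapping.lookup p m * mon_eval m (x + g)) \<in> polyfun d"
    by (intro polyfun_sum polyfun_scale polyfun_mono[OF polyfun_mon_eval_translate])
  then have "(\<lambda>x. mp_eval p (x + g)) \<in> polyfun d"
    by (simp add: mp_eval_superset[OF finite_keys order_refl])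
  then show thesis
    using that by (auto simp: polyfun_def fun_eq_iff)
qed

section \<open>Separated sets\<close>

definition separated :: "nat \<Rightarrow> ('k::field ^ 'n::finite) set \<Rightarrow> bool" where
  "separated d B \<longleftrightarrow> (\<forall>b\<in>B. \<exists>p\<in>deg_le (vanishing_ideal (B - {b})) d. mp_eval p b \<noteq> 0)"

lemma separated_empty: "separated d {}"
  by (simp add: separated_def)

lemma separated_subset: "separated d B \<Longrightarrow> T \<subseteq> B \<Longrightarrow> separated d T"
  unfolding separated_def deg_le_def vanishing_ideal_def by blast

text \<open>Augmentation step of the matroid. Conversely, if a separated \<open>B\<close> cannot be
  enlarged by \<open>z\<close>, then every polynomial of degree at most \<open>d\<close> vanishing
  on \<open>B\<close> vanishes at \<open>z\<close>.\<close>

lemma separated_insert: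
  assumes B: "separated d B" and p: "p \<in> deg_le (vanishing_ideal B) d" "mp_eval p z \<noteq> 0"
  shows "separated d (insert z B)"
  unfolding separated_def
proof
  fix b assume b: "b \<in> insert z B"
  show "\<exists>q\<in>deg_le (vanishing_ideal (insert z B - {b})) d. mp_eval q b \<noteq> 0"
  proof (cases "b = z")
    case True
    then show ?thesis using p by (intro bexI[of _ p]) (auto simp: deg_le_def vanishing_ideal_def)
  next
    case False
    then have "b \<in> B" using b by simp
    then obtain r where r: "r \<in> deg_le (vanishing_ideal (B - {b})) d" "mp_eval r b \<noteq> 0"
      using B by (auto simp: separated_def)
    \<comment> \<open>The coefficient makes \<open>q\<close> vanish at \<open>z\<close>; since
      \<open>p\<close> vanishes on \<open>B\<close>, the values of \<open>r\<close> there are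
      unchanged.\<close>
    define q where "q = r + mp_scale (- (mp_eval r z / mp_eval p z)) p"
    have eval: "mp_eval q x = mp_eval r x - mp_eval r z / mp_eval p z * mp_eval p x" for x
      unfolding q_def mp_eval_add mp_eval_scale by simp
    have "r \<in> deg_le UNIV d" "p \<in> deg_le UNIV d"
      using r(1) p(1) by (auto simp: deg_le_def)
    then have "q \<in> deg_le UNIV d"
      unfolding q_def by (intro mp.subspace_add mp.subspace_scale subspace_deg_le)
    then have "q \<in> deg_le (vanishing_ideal (insert z B - {b})) d"
      using r(1) p by (auto simp: deg_le_def vanishing_ideal_def eval)
    moreover have "mp_eval q b \<noteq> 0"
      using r(2) p(1) \<open>b \<in> B\<close> by (simp add: eval deg_le_def vanishing_ideal_def)
    ultimately show ?thesis by blast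
  qed
qed

text \<open>A maximal separated set between \<open>T\<close> and \<open>Z\<close> imposes the same
  conditions in degree at most \<open>d\<close> as all of \<open>Z\<close>: a polynomial vanishing
  on it but not at some \<open>z\<close> in \<open>Z\<close> would allow adding
  \<open>z\<close>.\<close>

lemma separated_extend:
  assumes Z: "finite Z" "T \<subseteq> Z" and T: "separated d T"
  obtains B where "T \<subseteq> B" "B \<subseteq> Z" "separated d B"
    "deg_le (vanishing_ideal B) d = deg_le (vanishing_ideal Z) d"
proof -
  let ?S = "{B. T \<subseteq> B \<and> B \<subseteq> Z \<and> separated d B}"
  have "finite ?S" using Z(1) by (auto intro: finite_subset[of _ "Pow Z"])
  moreover have "T \<in> ?S" using assms by auto
  ultimately obtain B where B: "B \<in> ?S" and max: "\<forall>B'\<in>?S. B \<subseteq> B' \<longrightarrow> B = B'"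
    by (metis (no_types, lifting) finite_has_maximal2)
  have "mp_eval p z = 0" if p: "p \<in> deg_le (vanishing_ideal B) d" and z: "z \<in> Z" for p z
  proof (rule ccontr)
    assume nz: "mp_eval p z \<noteq> 0"
    then have "z \<notin> B" using p by (auto simp: deg_le_def vanishing_ideal_def)
    moreover have "insert z B \<in> ?S" using separated_insert[OF _ p nz] B z by auto
    ultimately show False using max by blast
  qed
  then have "deg_le (vanishing_ideal B) d = deg_le (vanishing_ideal Z) d"
    using B by (auto simp: deg_le_def vanishing_ideal_def)
  then show thesis using that B by blast
qed

text \<open>Each point of a separated set imposes one new linear condition: the witness at
  \<open>t\<close> shows that evaluation at \<open>t\<close> is a nonzero functional on the
  polynomials vanishing on \<open>T\<close>, so its kernel has dimension one less.\<close>

lemma dim_vanishing_separated: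
  fixes T :: "('k::field ^ 'n::finite) set"
  assumes "finite T" "separated d T"
  shows "mp.dim (deg_le (vanishing_ideal T) d) + card T =
    mp.dim (deg_le (UNIV :: ('n, 'k) mpolynomial set) d)"
  using assms
proof (induction T)
  case empty
  then show ?case by (simp add: vanishing_ideal_empty)
next
  case (insert t T)
  let ?V = "deg_le (vanishing_ideal T) d"
  obtain p where p: "p \<in> ?V" "mp_eval p t \<noteq> 0"
    using insert by (auto simp: separated_def)
  have "?V \<subseteq> deg_le UNIV d" by (auto simp: deg_le_def)
  then have "?V \<subseteq> mp.span ((\<lambda>m. Poly_Mapping.single m 1) ` {m. mon_degree m \<le> d})"
    using deg_le_subset_span_monomials by blast
  then have "mp.dim ?V = Suc (mp.dim {w \<in> ?V. mp_eval w t = 0})"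
    by (rule mp.dim_kernel_functional[OF subspace_deg_le_vanishing_ideal])
      (use p finite_mon_degree_le in \<open>auto simp: mp_eval_add mp_eval_scale\<close>)
  moreover have "{w \<in> ?V. mp_eval w t = 0} = deg_le (vanishing_ideal (insert t T)) d"
    by (auto simp: deg_le_def vanishing_ideal_def)
  moreover have "separated d T" using insert.prems by (rule separated_subset) auto
  ultimately show ?case using insert by simp
qed

section \<open>The affine Hilbert function as a matroid rank\<close>

lemma affine_HF_eq_card_separated:
  assumes "finite X"
  obtains B where "B \<subseteq> X" "separated d B" "affine_HF X d = card B"
proof -
  obtain B where "{} \<subseteq> B" and B: "B \<subseteq> X" "separated d B"
    "deg_le (vanishing_ideal B) d = deg_le (vanishing_ideal X) d"
    by (rule separated_extend[OF assms empty_subsetI separated_empty])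
  have "finite B" using assms B(1) finite_subset by blast
  then have "affine_HF X d = card B"
    using dim_vanishing_separated[of B d] B by (simp add: affine_HF_def)
  then show thesis using that B by blast
qed

lemma affine_HF_le_card: "finite X \<Longrightarrow> affine_HF X d \<le> card X"
  by (rule affine_HF_eq_card_separated[of X d]) (auto simp: card_mono)

text \<open>Extending from \<open>T\<close> itself, rather than from the empty set, yields a maximal
  separated set that contains \<open>T\<close> and still has \<open>affine_HF X d\<close>
  points.\<close>

lemma card_separated_le_affine_HF:
  assumes "finite X" "T \<subseteq> X" "separated d T"
  shows "card T \<le> affine_HF X d"
proof -
  obtain B where B: "T \<subseteq> B" "B \<subseteq> X" "separated d B"
    "deg_le (vanishing_ideal B) d = deg_le (vanishing_ideal X) d"
    by (rule separated_extend[OF assms])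
  have fin: "finite B" using assms B(2) finite_subset by blast
  then have "affine_HF X d = card B"
    using dim_vanishing_separated[of B d] B by (simp add: affine_HF_def)
  then show ?thesis using B(1) fin by (simp add: card_mono)
qed

text \<open>The closure imposes no new condition in degree at most \<open>d\<close>, by its
  definition, and it contains \<open>Y\<close>.\<close>

lemma affine_HF_degree_closure: "affine_HF (degree_closure d Y) d = affine_HF Y d"
proof -
  have "deg_le (vanishing_ideal (degree_closure d Y)) d = deg_le (vanishing_ideal Y) d"
    by (auto simp: deg_le_def vanishing_ideal_def degree_closure_def)
  then show ?thesis by (simp add: affine_HF_def)
qed

text \<open>The witness for \<open>b + g\<close> in \<open>B\<close>, composed with translation by
  \<open>g\<close>, is a witness for \<open>b\<close>; the degree bound survives by
  \<open>deg_le_translate\<close>.\<close>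

lemma separated_translate:
  assumes "separated d B"
  shows "separated d {x. x + g \<in> B}"
  unfolding separated_def
proof
  fix b assume "b \<in> {x. x + g \<in> B}"
  then obtain p where p: "p \<in> deg_le (vanishing_ideal (B - {b + g})) d" "mp_eval p (b + g) \<noteq> 0"
    using assms by (auto simp: separated_def)
  then have "p \<in> deg_le UNIV d" by (simp add: deg_le_def)
  then obtain p' where p': "p' \<in> deg_le UNIV d" "\<And>x. mp_eval p' x = mp_eval p (x + g)"
    using deg_le_translate by blast
  then have "p' \<in> deg_le (vanishing_ideal ({x. x + g \<in> B} - {b})) d"
    using p(1) by (auto simp: deg_le_def vanishing_ideal_def)
  moreover have "mp_eval p' b \<noteq> 0" using p p' by simp
  ultimately show "\<exists>p\<in>deg_le (vanishing_ideal ({x. x + g \<in> B} - {b})) d. mp_eval p b \<noteq> 0"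
    by blast
qed

theorem theorem5p6:
  fixes Y :: "('k::{field,finite} ^ 'n::finite) set" and q n d :: nat
  assumes "CARD('k) = q" and "CARD('n) = n"
  shows "affine_HF (UNIV :: ('k ^ 'n) set) d * card (degree_closure d Y) \<le> q ^ n * card Y"
proof -
  let ?C = "degree_closure d Y"
  obtain B :: "('k ^ 'n) set" where "B \<subseteq> UNIV" and B: "separated d B" "affine_HF (UNIV :: ('k ^ 'n) set) d = card B"
    by (rule affine_HF_eq_card_separated[OF finite])
  have le: "card {c \<in> ?C. c + g \<in> B} \<le> card Y" for g
  proof -
    have "separated d {c \<in> ?C. c + g \<in> B}"
      using separated_translate[OF B(1), of g] by (rule separated_subset) auto
    then have "card {c \<in> ?C. c + g \<in> B} \<le> affine_HF ?C d"
      by (intro card_separated_le_affine_HF) auto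
    also have "\<dots> \<le> card Y"
      by (simp add: affine_HF_degree_closure affine_HF_le_card)
    finally show ?thesis .
  qed
  \<comment> \<open>For fixed \<open>c\<close>, each \<open>b\<close> in \<open>B\<close> is reached
    by exactly one translation, \<open>g = b - c\<close>.\<close>
  have translates: "card {g. c + g \<in> B} = card B" for c
    by (rule bij_betw_same_card[of "\<lambda>g. c + g"])
      (rule bij_betw_byWitness[of _ "\<lambda>b. b - c"], auto)
  \<comment> \<open>Double counting of the pairs \<open>(c, g)\<close> with \<open>c\<close> in the
    closure and \<open>c + g\<close> in \<open>B\<close>, first by \<open>c\<close>, then by
    \<open>g\<close>.\<close>
  have "card B * card ?C = (\<Sum>c\<in>?C. card {g. c + g \<in> B})"
    by (simp add: translates)
  also have "\<dots> = (\<Sum>g\<in>UNIV. card {c \<in> ?C. c + g \<in> B})"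
    using sum.swap_restrict[of ?C UNIV "\<lambda>_ _. 1::nat" "\<lambda>c g. c + g \<in> B"] by simp
  also have "\<dots> \<le> (\<Sum>g\<in>(UNIV :: ('k ^ 'n) set). card Y)"
    by (rule sum_mono) (rule le)
  also have "\<dots> = q ^ n * card Y"
    using assms by simp
  finally show ?thesis by (simp add: B(2))
qed

end
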